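(* Let $\Gamma=(\mathsf x_1:\mathsf A_1,\ldots,\mathsf x_n:\mathsf A_n)$ be a typing context. For every term $\Gamma\vdash\mathsf t:\mathsf A$ and every $(x,a,x')\in\rho_{\mathsf A_1\times\cdots\times\mathsf A_n}$, we have \[ ([\![\mathsf t]\!]\cdot x,\ [\![\mathsf t]\!]^{\bullet}\cdot x\cdot a,\ [\![\mathsf t]\!]\cdot x')\in\rho_{\mathsf A}, \] where $[\![\mathsf t]\!]^{\bullet}\in\mathcal Q_{\mathsf A_1\times\cdots\times\mathsf A_n\Rightarrow\mathsf A}$ is defined inductively by: - $[\![\mathsf x_i]\!]^{\bullet}\cdot(x_1,\ldots,x_n)\cdot(a_1,\ldots,a_n)=a_i$; - $[\![\underline r]\!]^{\bullet}\cdot x\cdot a=0$; - $[\![\phi(\mathsf t_1,\ldots,\mathsf t_n)]\!]^{\bullet}\cdot x\cdot a=\phi^{\mathrm d}([\![\mathsf t_1]\!]\cdot x,\ldots,[\![\mathsf t_n]\!]\cdot x,[\![\mathsf t_1]\!]^{\bullet}\cdot x\cdot a,\ldots,[\![\mathsf t_n]\!]^{\bullet}\cdot x\cdot a)$, where $\phi^{\mathrm d}\colon\mathbb R^n\times[0,+\infty]^n\to[0,+\infty]$ is $\phi^{\mathrm d}(y_1,\ldots,y_n,b_1,\ldots,b_n)=\bigwedge_{|y_1-z_1|\sqsupseteq b_1}\cdots\bigwedge_{|y_n-z_n|\sqsupseteq b_n}|\phi(y_1,\ldots,y_n)-\phi(z_1,\ldots,z_n)|$; - $[\![\mathsf t\,\mathsf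 s]\!]^{\bullet}\cdot x\cdot a=[\![\mathsf t]\!]^{\bullet}\cdot x\cdot a\cdot([\![\mathsf s]\!]\cdot x)\cdot([\![\mathsf s]\!]^{\bullet}\cdot x\cdot a)$; - $[\![\lambda\mathsf x{:}\mathsf A.\mathsf t]\!]^{\bullet}\cdot(x_1,\ldots,x_n)\cdot(a_1,\ldots,a_n)\cdot y\cdot b=[\![\mathsf t]\!]^{\bullet}\cdot(x_1,\ldots,x_n,y)\cdot(a_1,\ldots,a_n,b)$; - $[\![\langle\mathsf t,\mathsf s\rangle]\!]^{\bullet}\cdot x\cdot a=([\![\mathsf t]\!]^{\bullet}\cdot x\cdot a,[\![\mathsf s]\!]^{\bullet}\cdot x\cdot a)$; - $[\![\mathsf{fst}(\mathsf t)]\!]^{\bullet}\cdot x\cdot a$ (resp. $[\![\mathsf{snd}(\mathsf t)]\!]^{\bullet}\cdot x\cdot a$) is the first (resp. second) component of $[\![\mathsf t]\!]^{\bullet}\cdot x\cdot a$.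
   Context: The language $\Lambda_{\mathbb R}$ has types $\mathsf A,\mathsf B::=\mathsf{Real}\mid\mathsf A\times\mathsf B\mid\mathsf A\Rightarrow\mathsf B$ and terms $\mathsf x\mid\underline r\ (r\in\mathbb R)\mid\phi(\mathsf t_1,\ldots,\mathsf t_n)\ (\phi\colon\mathbb R^n\to\mathbb R\text{ any function})\mid\mathsf t\,\mathsf s\mid\lambda\mathsf x{:}\mathsf A.\mathsf t\mid\langle\mathsf t,\mathsf s\rangle\mid\mathsf{fst}(\mathsf t)\mid\mathsf{snd}(\mathsf t)$, with the standard simply-typed typing rules (the arguments of $\phi$ and its result have type $\mathsf{Real}$). $[\![-]\!]$ is the standard set-theoretic semantics: $[\![\mathsf{Real}]\!]=\mathbb R$, $[\![\mathsf A\times\mathsf B]\!]=[\![\mathsf A]\!]\times[\![\mathsf B]\!]$, $[\![\mathsf A\Rightarrow\mathsf B]\!]$ = set of all functions, and a term $\Gamma\vdash\mathsf t:\mathsf B$ denotes a function $[\![\mathsf t]\!]\colon[\![\mathsf A_1]\!]\times\cdots\times[\![\mathsf A_n]\!]\to[\![\mathsf B]\!]$; $f\cdot x$ denotes application (left-associative). For each type one defines a quantale $\mathcal Q_{\mathsf A}$ and a relation $\rho_{\mathsf A}\subseteq[\![\mathsf A]\!]\times\mathcal Q_{\mathsf A}\times[\![\mathsf A]\!]$: $\mathcal Q_{\mathsf{Real}}=[0,+\infty]$ is the Lawvere quantale (order reversed: $x\sqsubseteq y$ iff $x\geq y$, monoidal operation $+$, top element $0$), and $(x,a,x')\in\rho_{\mathsf{Real}}$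 iff $|x-x'|\sqsupseteq a$ (i.e. $|x-x'|\le a$); $\mathcal Q_{\mathsf A\times\mathsf B}=\mathcal Q_{\mathsf A}\times\mathcal Q_{\mathsf B}$ with $\rho_{\mathsf A\times\mathsf B}$ componentwise; $\mathcal Q_{\mathsf A\Rightarrow\mathsf B}$ is the set of functions from $[\![\mathsf A]\!]$ to the set of monotone functions $\mathcal Q_{\mathsf A}\to\mathcal Q_{\mathsf B}$ (pointwise order), and $(f,a,f')\in\rho_{\mathsf A\Rightarrow\mathsf B}$ iff for all $(x,b,x')\in\rho_{\mathsf A}$ and $g\in\{f,f'\}$, $(f\cdot x,a\cdot x\cdot b,g\cdot x')\in\rho_{\mathsf B}$. Meets $\bigwedge$ are taken in the reversed order $\sqsubseteq$ (so they are suprema of reals). *)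

theory Defs
  imports "HOL-Library.Extended_Nonnegative_Real"
begin

section \<open>The language\<close>

datatype ty = Real | Prod ty ty (infixr "\<^bold>\<times>" 70) | Fun ty ty (infixr "\<^bold>\<Rightarrow>" 65)

text \<open>
  Variables are nameless: \<open>Var i\<close> is the \<open>i\<close>-th variable (from 0) of the context
  \<open>A\<^sub>0, \<dots>, A\<^sub>n\<^sub>-\<^sub>1\<close>, and a \<open>\<lambda>\<close> binds the variable appended at the end of the context
  (de Bruijn levels). A primitive \<open>\<phi> : \<real>\<^sup>n \<rightarrow> \<real>\<close> is a function on lists; in \<open>Op \<phi> ts\<close>
  only its values on lists of length \<open>n = length ts\<close> are ever used.
\<close>

datatype tm =
    Var nat
  | Const real
  | Op "real list \<Rightarrow> real" "tm list"
  | App tm tm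
  | Lam ty tm
  | Pair tm tm
  | Fst tm
  | Snd tm

inductive typing :: "ty list \<Rightarrow> tm \<Rightarrow> ty \<Rightarrow> bool" ("(_/ \<turnstile> _ : _)" [50, 0, 50] 50) where
  Var: "i < length \<Gamma> \<Longrightarrow> \<Gamma> \<turnstile> Var i : \<Gamma> ! i"
| Const: "\<Gamma> \<turnstile> Const r : Real"
| Op: "(\<And>t. t \<in> set ts \<Longrightarrow> \<Gamma> \<turnstile> t : Real) \<Longrightarrow> \<Gamma> \<turnstile> Op \<phi> ts : Real"
| App: "\<Gamma> \<turnstile> t : A \<^bold>\<Rightarrow> B \<Longrightarrow> \<Gamma> \<turnstile> s : A \<Longrightarrow> \<Gamma> \<turnstile> App t s : B"
| Lam: "\<Gamma> @ [A] \<turnstile> t : B \<Longrightarrow> \<Gamma> \<turnstile> Lam A t : A \<^bold>\<Rightarrow> B"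
| Pair: "\<Gamma> \<turnstile> t : A \<Longrightarrow> \<Gamma> \<turnstile> s : B \<Longrightarrow> \<Gamma> \<turnstile> Pair t s : A \<^bold>\<times> B"
| Fst: "\<Gamma> \<turnstile> t : A \<^bold>\<times> B \<Longrightarrow> \<Gamma> \<turnstile> Fst t : A"
| Snd: "\<Gamma> \<turnstile> t : A \<^bold>\<times> B \<Longrightarrow> \<Gamma> \<turnstile> Snd t : B"

section \<open>Universes\<close>

text \<open>
  The set-theoretic semantics interprets the function types by full function spaces, so the
  sets \<open>\<lbrakk>A\<rbrakk>\<close> have cardinalities cofinal in beth-omega, and no single HOL type provably
  contains them all. They are therefore built as subsets of an arbitrary type \<open>'u\<close>, which
  comes with codes in \<open>'u\<close> for real numbers, elements of \<open>[0,\<infinity>]\<close>, pairs, and functions given,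
  as in set theory, by their graphs (\<open>'u \<rightharpoonup> 'u\<close>). The predicate \<open>adequate U A\<close> below says that
  \<open>'u\<close> is large enough for \<open>A\<close>: every real, pair and function needed to build \<open>\<lbrakk>A\<rbrakk>\<close> and \<open>Q\<^sub>A\<close>
  can be recovered from its code. It says nothing else, and for each bound on the height of
  types there is a HOL type \<open>'u\<close> with a universe adequate for all types up to that height: see
  \<open>adequate_base\<close> and \<open>adequate_step\<close>. In particular for each term \<open>t\<close> there is a universe
  adequate for all of the (finitely many) types in the typing derivation of \<open>t\<close>.
\<close>

record 'u universe =
  code_real :: "real \<Rightarrow> 'u"
  dec_real :: "'u \<Rightarrow> real"
  code_ext :: "ennreal \<Rightarrow> 'u"
  dec_ext :: "'u \<Rightarrow> ennreal"
  code_pair :: "'u \<times> 'u \<Rightarrow> 'u"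
  dec_pair :: "'u \<Rightarrow> 'u \<times> 'u"
  code_fun :: "('u \<rightharpoonup> 'u) \<Rightarrow> 'u"
  dec_fun :: "'u \<Rightarrow> ('u \<rightharpoonup> 'u)"

definition app :: "'u universe \<Rightarrow> 'u \<Rightarrow> 'u \<Rightarrow> 'u" where
  "app U f x = the (dec_fun U f x)"

definition pfst :: "'u universe \<Rightarrow> 'u \<Rightarrow> 'u" where
  "pfst U p = fst (dec_pair U p)"

definition psnd :: "'u universe \<Rightarrow> 'u \<Rightarrow> 'u" where
  "psnd U p = snd (dec_pair U p)"

definition lam :: "'u universe \<Rightarrow> 'u set \<Rightarrow> ('u \<Rightarrow> 'u) \<Rightarrow> 'u" where
  "lam U X f = code_fun U (\<lambda>x. if x \<in> X then Some (f x) else None)"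

definition maps :: "'u set \<Rightarrow> 'u set \<Rightarrow> ('u \<rightharpoonup> 'u) set" where
  "maps X Y = {f. dom f = X \<and> ran f \<subseteq> Y}"

definition mono_maps ::
  "'u set \<Rightarrow> ('u \<Rightarrow> 'u \<Rightarrow> bool) \<Rightarrow> 'u set \<Rightarrow> ('u \<Rightarrow> 'u \<Rightarrow> bool) \<Rightarrow> ('u \<rightharpoonup> 'u) set" where
  "mono_maps X leX Y leY = {f \<in> maps X Y. monotone_on X leX leY (\<lambda>x. the (f x))}"

section \<open>The sets \<open>\<lbrakk>A\<rbrakk>\<close>, the quantales \<open>Q\<^sub>A\<close> and the relations \<open>\<rho>\<^sub>A\<close>\<close>

primrec D :: "'u universe \<Rightarrow> ty \<Rightarrow> 'u set" where
  "D U Real = range (code_real U)"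
| "D U (A \<^bold>\<times> B) = code_pair U ` (D U A \<times> D U B)"
| "D U (A \<^bold>\<Rightarrow> B) = code_fun U ` maps (D U A) (D U B)"

text \<open>
  Carrier \<open>Q U A\<close> and order \<open>qle U A\<close> (the relation \<open>\<sqsubseteq>\<close>) of the quantale of \<open>A\<close>. On \<open>[0,\<infinity>]\<close>
  the order is reversed.
\<close>

fun Q :: "'u universe \<Rightarrow> ty \<Rightarrow> 'u set"
  and qle :: "'u universe \<Rightarrow> ty \<Rightarrow> 'u \<Rightarrow> 'u \<Rightarrow> bool" where
  "Q U Real = range (code_ext U)"
| "Q U (A \<^bold>\<times> B) = code_pair U ` (Q U A \<times> Q U B)"
| "Q U (A \<^bold>\<Rightarrow> B) =
     code_fun U ` maps (D U A) (code_fun U ` mono_maps (Q U A) (qle U A) (Q U B) (qle U B))"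
| "qle U Real p q \<longleftrightarrow> dec_ext U q \<le> dec_ext U p"
| "qle U (A \<^bold>\<times> B) p q \<longleftrightarrow>
     qle U A (pfst U p) (pfst U q) \<and> qle U B (psnd U p) (psnd U q)"
| "qle U (A \<^bold>\<Rightarrow> B) p q \<longleftrightarrow>
     (\<forall>x \<in> D U A. \<forall>b \<in> Q U A. qle U B (app U (app U p x) b) (app U (app U q x) b))"

primrec adequate :: "'u universe \<Rightarrow> ty \<Rightarrow> bool" where
  "adequate U Real \<longleftrightarrow>
     (\<forall>r. dec_real U (code_real U r) = r) \<and> (\<forall>e. dec_ext U (code_ext U e) = e)"
| "adequate U (A \<^bold>\<times> B) \<longleftrightarrow> adequate U A \<and> adequate U B \<and>
     (\<forall>p \<in> D U A \<times> D U B \<union> Q U A \<times> Q U B. dec_pair U (code_pair U p) = p)"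
| "adequate U (A \<^bold>\<Rightarrow> B) \<longleftrightarrow> adequate U A \<and> adequate U B \<and>
     (\<forall>f \<in> maps (D U A) (D U B) \<union>
            mono_maps (Q U A) (qle U A) (Q U B) (qle U B) \<union>
            maps (D U A) (code_fun U ` mono_maps (Q U A) (qle U A) (Q U B) (qle U B)).
        dec_fun U (code_fun U f) = f)"

primrec \<rho> :: "'u universe \<Rightarrow> ty \<Rightarrow> ('u \<times> 'u \<times> 'u) set" where
  "\<rho> U Real = {(x, a, x') \<in> D U Real \<times> Q U Real \<times> D U Real.
     ennreal \<bar>dec_real U x - dec_real U x'\<bar> \<le> dec_ext U a}"
| "\<rho> U (A \<^bold>\<times> B) = {(p, a, p') \<in> D U (A \<^bold>\<times> B) \<times> Q U (A \<^bold>\<times> B) \<times> D U (A \<^bold>\<times> B).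
     (pfst U p, pfst U a, pfst U p') \<in> \<rho> U A \<and> (psnd U p, psnd U a, psnd U p') \<in> \<rho> U B}"
| "\<rho> U (A \<^bold>\<Rightarrow> B) = {(f, a, f') \<in> D U (A \<^bold>\<Rightarrow> B) \<times> Q U (A \<^bold>\<Rightarrow> B) \<times> D U (A \<^bold>\<Rightarrow> B).
     \<forall>(x, b, x') \<in> \<rho> U A. \<forall>g \<in> {f, f'}.
       (app U f x, app U (app U a x) b, app U g x') \<in> \<rho> U B}"

text \<open>
  The product \<open>A\<^sub>1 \<times> \<dots> \<times> A\<^sub>n\<close> of a context (with \<open>n = 0\<close> allowed) is interpreted by lists
  of length \<open>n\<close>, with order and relation componentwise.
\<close>

definition D_ctx :: "'u universe \<Rightarrow> ty list \<Rightarrow> 'u list set" where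
  "D_ctx U \<Gamma> = {xs. list_all2 (\<lambda>x A. x \<in> D U A) xs \<Gamma>}"

definition Q_ctx :: "'u universe \<Rightarrow> ty list \<Rightarrow> 'u list set" where
  "Q_ctx U \<Gamma> = {as. list_all2 (\<lambda>a A. a \<in> Q U A) as \<Gamma>}"

definition qle_ctx :: "'u universe \<Rightarrow> ty list \<Rightarrow> 'u list \<Rightarrow> 'u list \<Rightarrow> bool" where
  "qle_ctx U \<Gamma> as bs \<longleftrightarrow> (\<forall>i < length \<Gamma>. qle U (\<Gamma> ! i) (as ! i) (bs ! i))"

definition \<rho>_ctx :: "'u universe \<Rightarrow> ty list \<Rightarrow> ('u list \<times> 'u list \<times> 'u list) set" where
  "\<rho>_ctx U \<Gamma> = {(xs, as, xs') \<in> D_ctx U \<Gamma> \<times> Q_ctx U \<Gamma> \<times> D_ctx U \<Gamma>.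
     \<forall>i < length \<Gamma>. (xs ! i, as ! i, xs' ! i) \<in> \<rho> U (\<Gamma> ! i)}"

text \<open>The carrier of the quantale of \<open>A\<^sub>1 \<times> \<dots> \<times> A\<^sub>n \<Rightarrow> A\<close>.\<close>

definition Q_ctx_fun ::
  "'u universe \<Rightarrow> ty list \<Rightarrow> ty \<Rightarrow> ('u list \<Rightarrow> 'u list \<Rightarrow> 'u) set" where
  "Q_ctx_fun U \<Gamma> A = {F. \<forall>xs \<in> D_ctx U \<Gamma>.
     (\<forall>as \<in> Q_ctx U \<Gamma>. F xs as \<in> Q U A) \<and>
     monotone_on (Q_ctx U \<Gamma>) (qle_ctx U \<Gamma>) (qle U A) (F xs)}"

section \<open>Semantics of terms\<close>

fun sem :: "'u universe \<Rightarrow> tm \<Rightarrow> 'u list \<Rightarrow> 'u" where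
  "sem U (Var i) xs = xs ! i"
| "sem U (Const r) xs = code_real U r"
| "sem U (Op \<phi> ts) xs = code_real U (\<phi> (map (\<lambda>t. dec_real U (sem U t xs)) ts))"
| "sem U (App t s) xs = app U (sem U t xs) (sem U s xs)"
| "sem U (Lam A t) xs = lam U (D U A) (\<lambda>y. sem U t (xs @ [y]))"
| "sem U (Pair t s) xs = code_pair U (sem U t xs, sem U s xs)"
| "sem U (Fst t) xs = pfst U (sem U t xs)"
| "sem U (Snd t) xs = psnd U (sem U t xs)"

text \<open>The meet in the reversed order of \<open>[0,\<infinity>]\<close> is the usual supremum.\<close>

definition deriv_op :: "(real list \<Rightarrow> real) \<Rightarrow> real list \<Rightarrow> ennreal list \<Rightarrow> ennreal" where
  "deriv_op \<phi> ys bs =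
     (SUP zs \<in> {zs. length zs = length ys \<and>
                    (\<forall>i < length ys. ennreal \<bar>ys ! i - zs ! i\<bar> \<le> bs ! i)}.
        ennreal \<bar>\<phi> ys - \<phi> zs\<bar>)"

text \<open>The map \<open>\<lbrakk>t\<rbrakk>\<^sup>\<bullet>\<close>.\<close>

fun dsem :: "'u universe \<Rightarrow> tm \<Rightarrow> 'u list \<Rightarrow> 'u list \<Rightarrow> 'u" where
  "dsem U (Var i) xs as = as ! i"
| "dsem U (Const r) xs as = code_ext U 0"
| "dsem U (Op \<phi> ts) xs as = code_ext U
     (deriv_op \<phi> (map (\<lambda>t. dec_real U (sem U t xs)) ts)
                 (map (\<lambda>t. dec_ext U (dsem U t xs as)) ts))"
| "dsem U (App t s) xs as = app U (app U (dsem U t xs as) (sem U s xs)) (dsem U s xs as)"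
| "dsem U (Lam A t) xs as =
     lam U (D U A) (\<lambda>y. lam U (Q U A) (\<lambda>b. dsem U t (xs @ [y]) (as @ [b])))"
| "dsem U (Pair t s) xs as = code_pair U (dsem U t xs as, dsem U s xs as)"
| "dsem U (Fst t) xs as = pfst U (dsem U t xs as)"
| "dsem U (Snd t) xs as = psnd U (dsem U t xs as)"

text \<open>
  \<open>occ \<Gamma> t\<close> is the set of the types occurring in the judgements of the typing derivation of
  \<open>t\<close> in context \<open>\<Gamma>\<close>.
\<close>

fun occ :: "ty list \<Rightarrow> tm \<Rightarrow> ty set" where
  "occ \<Gamma> (Var i) = set \<Gamma>"
| "occ \<Gamma> (Const r) = {Real} \<union> set \<Gamma>"
| "occ \<Gamma> (Op \<phi> ts) = {Real} \<union> set \<Gamma> \<union> (\<Union>t \<in> set ts. occ \<Gamma> t)"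
| "occ \<Gamma> (App t s) = {B. \<Gamma> \<turnstile> App t s : B} \<union> occ \<Gamma> t \<union> occ \<Gamma> s"
| "occ \<Gamma> (Lam A t) = {B. \<Gamma> \<turnstile> Lam A t : B} \<union> occ (\<Gamma> @ [A]) t"
| "occ \<Gamma> (Pair t s) = {B. \<Gamma> \<turnstile> Pair t s : B} \<union> occ \<Gamma> t \<union> occ \<Gamma> s"
| "occ \<Gamma> (Fst t) = {B. \<Gamma> \<turnstile> Fst t : B} \<union> occ \<Gamma> t"
| "occ \<Gamma> (Snd t) = {B. \<Gamma> \<turnstile> Snd t : B} \<union> occ \<Gamma> t"

section \<open>Existence of adequate universes\<close>

primrec height :: "ty \<Rightarrow> nat" where
  "height Real = 0"
| "height (A \<^bold>\<times> B) = Suc (max (height A) (height B))"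
| "height (A \<^bold>\<Rightarrow> B) = Suc (max (height A) (height B))"

theorem adequate_base: "\<exists>U :: (real + ennreal) universe. \<forall>A. height A \<le> 0 \<longrightarrow> adequate U A"
proof -
  define U :: "(real + ennreal) universe" where
    "U = \<lparr>code_real = Inl, dec_real = projl, code_ext = Inr, dec_ext = projr,
          code_pair = undefined, dec_pair = undefined, code_fun = undefined, dec_fun = undefined\<rparr>"
  have "adequate U A" if "height A \<le> 0" for A
    using that by (cases A) (auto simp: U_def)
  then show ?thesis by blast
qed

type_synonym 'u step = "'u + ('u \<times> 'u) + ('u \<rightharpoonup> 'u)"

definition lift :: "('u \<rightharpoonup> 'u) \<Rightarrow> ('u step \<rightharpoonup> 'u step)" where
  "lift f z = (case z of Inl x \<Rightarrow> map_option Inl (f x) | Inr _ \<Rightarrow> None)"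

definition unlift :: "('u step \<rightharpoonup> 'u step) \<Rightarrow> ('u \<rightharpoonup> 'u)" where
  "unlift g x = map_option projl (g (Inl x))"

text \<open>Old codes are kept whenever they can be decoded; otherwise a new code is used.\<close>

definition step :: "'u universe \<Rightarrow> 'u step universe" where
  "step U = \<lparr>
     code_real = (\<lambda>r. Inl (code_real U r)),
     dec_real = (\<lambda>z. dec_real U (projl z)),
     code_ext = (\<lambda>e. Inl (code_ext U e)),
     dec_ext = (\<lambda>z. dec_ext U (projl z)),
     code_pair = (\<lambda>(y, z). let p = (projl y, projl z) in
       if dec_pair U (code_pair U p) = p then Inl (code_pair U p) else Inr (Inl p)),
     dec_pair = (\<lambda>z. map_prod Inl Inl
       (case z of Inl c \<Rightarrow> dec_pair U c | Inr w \<Rightarrow> projl w)),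
     code_fun = (\<lambda>g. let f = unlift g in
       if dec_fun U (code_fun U f) = f then Inl (code_fun U f) else Inr (Inr f)),
     dec_fun = (\<lambda>z. lift (case z of Inl c \<Rightarrow> dec_fun U c | Inr w \<Rightarrow> projr w))\<rparr>"

lemma unlift_lift [simp]: "unlift (lift f) = f"
  by (auto simp: lift_def unlift_def fun_eq_iff option.map_comp comp_def option.map_ident)

lemma step_real [simp]:
  "code_real (step U) r = Inl (code_real U r)" "dec_real (step U) (Inl x) = dec_real U x"
  "code_ext (step U) e = Inl (code_ext U e)" "dec_ext (step U) (Inl x) = dec_ext U x"
  by (auto simp: step_def)

lemma step_dec [simp]:
  "dec_pair (step U) (Inl c) = map_prod Inl Inl (dec_pair U c)"
  "dec_fun (step U) (Inl c) = lift (dec_fun U c)"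
  by (auto simp: step_def)

lemma step_pair: "dec_pair (step U) (code_pair (step U) (Inl x, Inl y)) = (Inl x, Inl y)"
  by (auto simp: step_def Let_def)

lemma step_fun: "dec_fun (step U) (code_fun (step U) (lift f)) = lift f"
  by (auto simp: step_def Let_def)

lemma step_old_pair:
  "dec_pair U (code_pair U (x, y)) = (x, y) \<Longrightarrow>
   code_pair (step U) (Inl x, Inl y) = Inl (code_pair U (x, y))"
  by (auto simp: step_def Let_def)

lemma step_old_fun:
  "dec_fun U (code_fun U f) = f \<Longrightarrow> code_fun (step U) (lift f) = Inl (code_fun U f)"
  by (auto simp: step_def Let_def)

lemma lift_maps: "maps (Inl ` X) (Inl ` Y) = lift ` maps X Y"
proof (rule set_eqI, rule iffI)
  fix g :: "'a step \<rightharpoonup> 'a step"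
  assume "g \<in> maps (Inl ` X) (Inl ` Y)"
  then have d: "dom g = Inl ` X" and r: "ran g \<subseteq> Inl ` Y" by (auto simp: maps_def)
  have g: "g = lift (unlift g)"
  proof
    fix z
    show "g z = lift (unlift g) z"
    proof (cases "g z")
      case None
      then show ?thesis by (cases z) (auto simp: lift_def unlift_def)
    next
      case (Some w)
      then obtain x where z: "z = Inl x" using d by blast
      obtain y where "w = Inl y" using Some r by (auto simp: ran_def)
      with z Some show ?thesis by (auto simp: lift_def unlift_def)
    qed
  qed
  moreover have "unlift g \<in> maps X Y"
  proof -
    have "x \<in> dom (unlift g) \<longleftrightarrow> x \<in> X" for x
    proof -
      have "x \<in> dom (unlift g) \<longleftrightarrow> Inl x \<in> dom g" by (auto simp: unlift_def dom_def)
      then show ?thesis using d by auto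
    qed
    moreover have "ran (unlift g) \<subseteq> Y"
      using r by (fastforce simp: unlift_def ran_def)
    ultimately show ?thesis by (auto simp: maps_def)
  qed
  ultimately show "g \<in> lift ` maps X Y" by blast
next
  fix g :: "'a step \<rightharpoonup> 'a step"
  assume "g \<in> lift ` maps X Y"
  then obtain f where f: "g = lift f" "dom f = X" "ran f \<subseteq> Y" by (auto simp: maps_def)
  have "dom g = Inl ` X"
  proof (rule set_eqI)
    show "z \<in> dom g \<longleftrightarrow> z \<in> Inl ` X" for z
      unfolding f(2)[symmetric] by (cases z) (auto simp: f(1) lift_def image_iff domIff)
  qed
  moreover have "ran g \<subseteq> Inl ` Y"
  proof
    fix w assume "w \<in> ran g"
    then obtain z where "lift f z = Some w" by (auto simp: f(1) ran_def)
    then obtain x y where "f x = Some y" "w = Inl y" by (cases z) (auto simp: lift_def)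
    then show "w \<in> Inl ` Y" using f(3) by (auto simp: ran_def)
  qed
  ultimately show "g \<in> maps (Inl ` X) (Inl ` Y)" by (simp add: maps_def)
qed

lemma lift_mono_maps:
  assumes X: "\<And>p q. p \<in> X \<Longrightarrow> q \<in> X \<Longrightarrow> leX' (Inl p) (Inl q) \<longleftrightarrow> leX p q"
    and Y: "\<And>p q. p \<in> Y \<Longrightarrow> q \<in> Y \<Longrightarrow> leY' (Inl p) (Inl q) \<longleftrightarrow> leY p q"
  shows "mono_maps (Inl ` X) leX' (Inl ` Y) leY' = lift ` mono_maps X leX Y leY"
proof -
  have "monotone_on (Inl ` X) leX' leY' (\<lambda>z. the (lift f z)) \<longleftrightarrow>
        monotone_on X leX leY (\<lambda>x. the (f x))" if f: "f \<in> maps X Y" for f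
  proof -
    have *: "the (lift f (Inl x)) = Inl (the (f x)) \<and> the (f x) \<in> Y" if "x \<in> X" for x
    proof -
      from f that have "x \<in> dom f" by (simp add: maps_def)
      then obtain y where "f x = Some y" by blast
      moreover from this have "y \<in> Y" using f by (auto simp: maps_def ran_def)
      ultimately show ?thesis by (simp add: lift_def)
    qed
    show ?thesis
      unfolding monotone_on_def using X Y * by auto
  qed
  then show ?thesis by (auto simp: mono_maps_def lift_maps)
qed

lemma app_step: "x \<in> dom (dec_fun U f) \<Longrightarrow> app (step U) (Inl f) (Inl x) = Inl (app U f x)"
  by (auto simp: app_def lift_def)

lemma code_fun_image:
  assumes "\<And>f. f \<in> F \<Longrightarrow> dec_fun U (code_fun U f) = f"
  shows "code_fun (step U) ` lift ` F = Inl ` code_fun U ` F"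
  using assms by (force simp: image_iff step_old_fun)

lemma step_adequate:
  "adequate U A \<Longrightarrow>
   D (step U) A = Inl ` D U A \<and> Q (step U) A = Inl ` Q U A \<and>
   (\<forall>p \<in> Q U A. \<forall>q \<in> Q U A. qle (step U) A (Inl p) (Inl q) \<longleftrightarrow> qle U A p q) \<and>
   adequate (step U) A"
proof (induction A)
  case Real
  then show ?case by (auto simp: image_image)
next
  case (Prod A B)
  then have ih:
    "D (step U) A = Inl ` D U A" "D (step U) B = Inl ` D U B"
    "Q (step U) A = Inl ` Q U A" "Q (step U) B = Inl ` Q U B"
    "\<And>p q. p \<in> Q U A \<Longrightarrow> q \<in> Q U A \<Longrightarrow> qle (step U) A (Inl p) (Inl q) \<longleftrightarrow> qle U A p q"
    "\<And>p q. p \<in> Q U B \<Longrightarrow> q \<in> Q U B \<Longrightarrow> qle (step U) B (Inl p) (Inl q) \<longleftrightarrow> qle U B p q"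
    "adequate (step U) A" "adequate (step U) B"
    by auto
  have dD: "x \<in> D U A \<Longrightarrow> y \<in> D U B \<Longrightarrow> dec_pair U (code_pair U (x, y)) = (x, y)" for x y
    using Prod.prems by auto
  have dQ: "x \<in> Q U A \<Longrightarrow> y \<in> Q U B \<Longrightarrow> dec_pair U (code_pair U (x, y)) = (x, y)" for x y
    using Prod.prems by auto
  have img: "code_pair (step U) ` (Inl ` X \<times> Inl ` Y) = Inl ` code_pair U ` (X \<times> Y)"
    if "\<And>x y. x \<in> X \<Longrightarrow> y \<in> Y \<Longrightarrow> dec_pair U (code_pair U (x, y)) = (x, y)" for X Y
    using that by (force simp: image_iff step_old_pair)
  have "D (step U) (A \<^bold>\<times> B) = Inl ` D U (A \<^bold>\<times> B)" by (simp add: ih img dD)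
  moreover have "Q (step U) (A \<^bold>\<times> B) = Inl ` Q U (A \<^bold>\<times> B)" by (simp add: ih img dQ)
  moreover have "\<forall>p \<in> Q U (A \<^bold>\<times> B). \<forall>q \<in> Q U (A \<^bold>\<times> B).
      qle (step U) (A \<^bold>\<times> B) (Inl p) (Inl q) \<longleftrightarrow> qle U (A \<^bold>\<times> B) p q"
    by (auto simp: pfst_def psnd_def dQ ih)
  moreover have "adequate (step U) (A \<^bold>\<times> B)" by (auto simp: ih step_pair)
  ultimately show ?case by blast
next
  case (Fun A B)
  then have ih:
    "D (step U) A = Inl ` D U A" "D (step U) B = Inl ` D U B"
    "Q (step U) A = Inl ` Q U A" "Q (step U) B = Inl ` Q U B"
    "\<And>p q. p \<in> Q U A \<Longrightarrow> q \<in> Q U A \<Longrightarrow> qle (step U) A (Inl p) (Inl q) \<longleftrightarrow> qle U A p q"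
    "\<And>p q. p \<in> Q U B \<Longrightarrow> q \<in> Q U B \<Longrightarrow> qle (step U) B (Inl p) (Inl q) \<longleftrightarrow> qle U B p q"
    "adequate (step U) A" "adequate (step U) B"
    by auto
  let ?M = "mono_maps (Q U A) (qle U A) (Q U B) (qle U B)"
  let ?M' = "mono_maps (Q (step U) A) (qle (step U) A) (Q (step U) B) (qle (step U) B)"
  have M: "?M' = lift ` ?M" unfolding ih(3,4) using ih(5,6) by (intro lift_mono_maps) auto
  have dD: "f \<in> maps (D U A) (D U B) \<Longrightarrow> dec_fun U (code_fun U f) = f" for f
    using Fun.prems by auto
  have dM: "f \<in> ?M \<Longrightarrow> dec_fun U (code_fun U f) = f" for f
    using Fun.prems by auto
  have dQ: "f \<in> maps (D U A) (code_fun U ` ?M) \<Longrightarrow> dec_fun U (code_fun U f) = f" for f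
    using Fun.prems by auto
  have cM: "code_fun (step U) ` ?M' = Inl ` code_fun U ` ?M"
    unfolding M using dM by (rule code_fun_image)
  have "D (step U) (A \<^bold>\<Rightarrow> B) = Inl ` D U (A \<^bold>\<Rightarrow> B)"
    by (simp add: ih lift_maps code_fun_image dD)
  moreover have "Q (step U) (A \<^bold>\<Rightarrow> B) = Inl ` Q U (A \<^bold>\<Rightarrow> B)"
    using dQ by (simp add: cM ih(1) lift_maps code_fun_image)
  moreover have "qle (step U) (A \<^bold>\<Rightarrow> B) (Inl p) (Inl q) \<longleftrightarrow> qle U (A \<^bold>\<Rightarrow> B) p q"
    if "p \<in> Q U (A \<^bold>\<Rightarrow> B)" "q \<in> Q U (A \<^bold>\<Rightarrow> B)" for p q
  proof -
    have "app (step U) (app (step U) (Inl r) (Inl x)) (Inl b) = Inl (app U (app U r x) b) \<and>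
          app U (app U r x) b \<in> Q U B"
      if r: "r \<in> Q U (A \<^bold>\<Rightarrow> B)" and x: "x \<in> D U A" and b: "b \<in> Q U A" for r x b
    proof -
      obtain f where f: "f \<in> maps (D U A) (code_fun U ` ?M)" "r = code_fun U f"
        using r by auto
      then have rf: "dec_fun U r = f" using dQ by auto
      then have xd: "x \<in> dom (dec_fun U r)" using f x by (simp add: maps_def)
      then obtain c where c: "f x = Some c" using rf by blast
      then have rx: "app U r x = c" by (simp add: app_def rf)
      have "c \<in> code_fun U ` ?M" using c f(1) by (auto simp: maps_def ran_def)
      then obtain g where g: "g \<in> ?M" "dec_fun U c = g" using dM by auto
      have bd: "b \<in> dom (dec_fun U c)" using g b by (simp add: mono_maps_def maps_def)
      then obtain d where d: "g b = Some d" using g(2) by blast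
      then have "d \<in> Q U B" using g(1) by (auto simp: mono_maps_def maps_def ran_def)
      moreover have "app U c b = d" by (simp add: app_def g(2) d)
      ultimately show ?thesis using app_step[OF xd] app_step[OF bd] by (simp add: rx)
    qed
    then show ?thesis using that by (simp add: ih(1,3,6))
  qed
  moreover have "adequate (step U) (A \<^bold>\<Rightarrow> B)"
  proof -
    have "maps (D (step U) A) (code_fun (step U) ` ?M') = lift ` maps (D U A) (code_fun U ` ?M)"
      unfolding cM ih(1) by (rule lift_maps)
    then have "f \<in> range lift"
      if "f \<in> maps (D (step U) A) (D (step U) B) \<union> ?M' \<union>
              maps (D (step U) A) (code_fun (step U) ` ?M')" for f
      using that M by (auto simp: ih(1,2) lift_maps)
    then show ?thesis using ih(7,8) step_fun by (fastforce simp del: step_dec)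
  qed
  ultimately show ?case by blast
qed

theorem adequate_step:
  assumes "\<exists>U :: 'u universe. \<forall>A. height A \<le> n \<longrightarrow> adequate U A"
  shows "\<exists>U :: 'u step step universe. \<forall>A. height A \<le> Suc n \<longrightarrow> adequate U A"
proof -
  obtain U :: "'u universe" where U: "height A \<le> n \<Longrightarrow> adequate U A" for A
    using assms by blast
  let ?S = "step U" and ?T = "step (step U)"
  have "adequate ?T C" if C: "height C \<le> Suc n" for C
  proof (cases C)
    case Real
    then show ?thesis using U[of C] step_adequate by fastforce
  next
    case (Prod A B)
    then have A: "adequate U A" and B: "adequate U B" using U C by auto
    note a = step_adequate[OF A] step_adequate[OF B]
    note b = step_adequate[of ?S A] step_adequate[of ?S B]
    show ?thesis using a b by (auto simp: Prod step_pair)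
  next
    case (Fun A B)
    then have A: "adequate U A" and B: "adequate U B" using U C by auto
    note a = step_adequate[OF A] step_adequate[OF B]
    then have b:
      "D ?T A = Inl ` D ?S A" "D ?T B = Inl ` D ?S B"
      "Q ?T A = Inl ` Q ?S A" "Q ?T B = Inl ` Q ?S B"
      "adequate ?T A" "adequate ?T B"
      using step_adequate[of ?S A] step_adequate[of ?S B] by auto
    let ?MU = "mono_maps (Q U A) (qle U A) (Q U B) (qle U B)"
    let ?MS = "mono_maps (Q ?S A) (qle ?S A) (Q ?S B) (qle ?S B)"
    let ?MT = "mono_maps (Q ?T A) (qle ?T A) (Q ?T B) (qle ?T B)"
    have MS: "?MS = lift ` ?MU"
      using a by (auto intro!: lift_mono_maps)
    have MT: "?MT = lift ` ?MS"
      unfolding b(3,4) using a step_adequate[of ?S A] step_adequate[of ?S B]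
      by (intro lift_mono_maps) auto
    have cM: "code_fun ?T ` ?MT = Inl ` code_fun ?S ` ?MS"
      unfolding MT by (rule code_fun_image) (auto simp: MS step_fun)
    have "maps (D ?T A) (code_fun ?T ` ?MT) = lift ` maps (D ?S A) (code_fun ?S ` ?MS)"
      unfolding cM b(1) by (rule lift_maps)
    then have "f \<in> range lift"
      if "f \<in> maps (D ?T A) (D ?T B) \<union> ?MT \<union> maps (D ?T A) (code_fun ?T ` ?MT)" for f
      using that MT by (auto simp: b(1,2) lift_maps)
    then have "dec_fun ?T (code_fun ?T f) = f"
      if "f \<in> maps (D ?T A) (D ?T B) \<union> ?MT \<union> maps (D ?T A) (code_fun ?T ` ?MT)" for f
      using that step_fun by fastforce
    then show ?thesis using b(5,6) by (simp add: Fun)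
  qed
  then show ?thesis by blast
qed

end

theory Submission
  imports Defs
begin

text \<open>
  A logical-relations argument by induction on the typing derivation. The point that is not
  routine is the case of \<open>\<lambda>\<close>: the relation at a function type also compares \<open>f x\<close> with
  \<open>f x'\<close>, so the induction hypothesis is needed at \<open>(x, a, x)\<close> besides \<open>(x, a, x')\<close>. This is
  available because every \<open>\<rho>\<^sub>A\<close> is left quasi-reflexive.
  Monotonicity of \<open>\<lbrakk>t\<rbrakk>\<^sup>\<bullet>\<close> and its values being in \<open>Q\<^sub>A\<close> must be proved
  simultaneously, as the latter at a function type requires the former.
\<close>

section \<open>The preorder on the quantales\<close>

text \<open>The order compares decoded values, so this holds for every \<open>p\<close>, in the
  carrier or not. It serves where only some entries of a context move.\<close>

lemma qle_refl: "qle U A p p"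
  by (induction A arbitrary: p) auto

text \<open>Needed for application, where the function and its argument move one after the
  other.\<close>

lemma qle_trans: "qle U A p q \<Longrightarrow> qle U A q r \<Longrightarrow> qle U A p r"
proof (induction A arbitrary: p q r)
  case (Fun A B)
  show ?case
    unfolding qle.simps
  proof (intro ballI)
    fix x b
    assume "x \<in> D U A" "b \<in> Q U A"
    then show "qle U B (app U (app U p x) b) (app U (app U r x) b)"
      using Fun.prems by (auto intro: Fun.IH(2)[of _ "app U (app U q x) b"])
  qed
qed auto

section \<open>Decoding of reals, pairs and function graphs\<close>

lemma dec_ext_code [simp]: "adequate U Real \<Longrightarrow> dec_ext U (code_ext U e) = e"
  by simp

lemma dec_real_code [simp]: "adequate U Real \<Longrightarrow> dec_real U (code_real U r) = r"
  by simp

lemma proj_code_pair_D: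
  assumes "adequate U (A \<^bold>\<times> B)" "x \<in> D U A" "y \<in> D U B"
  shows "pfst U (code_pair U (x, y)) = x" "psnd U (code_pair U (x, y)) = y"
proof -
  have "dec_pair U (code_pair U (x, y)) = (x, y)" using assms by auto
  then show "pfst U (code_pair U (x, y)) = x" "psnd U (code_pair U (x, y)) = y"
    by (simp_all add: pfst_def psnd_def)
qed

lemma proj_code_pair_Q:
  assumes "adequate U (A \<^bold>\<times> B)" "x \<in> Q U A" "y \<in> Q U B"
  shows "pfst U (code_pair U (x, y)) = x" "psnd U (code_pair U (x, y)) = y"
proof -
  have "dec_pair U (code_pair U (x, y)) = (x, y)" using assms by auto
  then show "pfst U (code_pair U (x, y)) = x" "psnd U (code_pair U (x, y)) = y"
    by (simp_all add: pfst_def psnd_def)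
qed

lemma proj_in_D:
  assumes "adequate U (A \<^bold>\<times> B)" "p \<in> D U (A \<^bold>\<times> B)"
  shows "pfst U p \<in> D U A" "psnd U p \<in> D U B"
  using assms(2) proj_code_pair_D[OF assms(1)] by auto

lemma proj_in_Q:
  assumes "adequate U (A \<^bold>\<times> B)" "p \<in> Q U (A \<^bold>\<times> B)"
  shows "pfst U p \<in> Q U A" "psnd U p \<in> Q U B"
  using assms(2) proj_code_pair_Q[OF assms(1)] by auto

lemma restrict_in_maps:
  "(\<And>x. x \<in> X \<Longrightarrow> f x \<in> Y) \<Longrightarrow> (\<lambda>x. if x \<in> X then Some (f x) else None) \<in> maps X Y"
  by (auto simp: maps_def ran_def split: if_splits)

lemma maps_the_in: "f \<in> maps X Y \<Longrightarrow> x \<in> X \<Longrightarrow> the (f x) \<in> Y"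
  by (force simp: maps_def ran_def)

lemma app_in_D:
  assumes "adequate U (A \<^bold>\<Rightarrow> B)" "f \<in> D U (A \<^bold>\<Rightarrow> B)" "x \<in> D U A"
  shows "app U f x \<in> D U B"
proof -
  obtain h where "h \<in> maps (D U A) (D U B)" "f = code_fun U h" using assms(2) by auto
  then show ?thesis using assms(1,3) by (simp add: app_def maps_the_in)
qed

lemma lam_in_D:
  assumes "\<And>y. y \<in> D U A \<Longrightarrow> f y \<in> D U B"
  shows "lam U (D U A) f \<in> D U (A \<^bold>\<Rightarrow> B)"
  using restrict_in_maps[of "D U A" f "D U B"] assms by (auto simp: lam_def)

lemma app_lam_D:
  assumes "adequate U (A \<^bold>\<Rightarrow> B)" "\<And>y. y \<in> D U A \<Longrightarrow> f y \<in> D U B" "x \<in> D U A"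
  shows "app U (lam U (D U A) f) x = f x"
  using restrict_in_maps[of "D U A" f "D U B"] assms by (simp add: lam_def app_def)

text \<open>The code \<open>a\<close> has two layers: its graph sends \<open>x\<close> to the code
  of a second graph, which is monotone by definition of the carrier. Decoding both layers gives
  membership and monotonicity together.\<close>

lemma app_in_Q:
  assumes ad: "adequate U (A \<^bold>\<Rightarrow> B)" and a: "a \<in> Q U (A \<^bold>\<Rightarrow> B)" and x: "x \<in> D U A"
  shows app_app_in_Q: "b \<in> Q U A \<Longrightarrow> app U (app U a x) b \<in> Q U B"
    and app_app_mono: "monotone_on (Q U A) (qle U A) (qle U B) (app U (app U a x))"
proof -
  let ?M = "mono_maps (Q U A) (qle U A) (Q U B) (qle U B)"
  obtain h where h: "h \<in> maps (D U A) (code_fun U ` ?M)" "a = code_fun U h" using a by auto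
  then have "app U a x \<in> code_fun U ` ?M"
    using ad x by (simp add: app_def maps_the_in)
  then obtain k where k: "k \<in> ?M" "app U a x = code_fun U k" by blast
  then have "app U (app U a x) = (\<lambda>b. the (k b))"
    using ad by (simp add: app_def fun_eq_iff)
  then show "b \<in> Q U A \<Longrightarrow> app U (app U a x) b \<in> Q U B"
    and "monotone_on (Q U A) (qle U A) (qle U B) (app U (app U a x))"
    using k(1) by (auto simp: mono_maps_def maps_the_in)
qed

text \<open>Adequacy guarantees decoding only for graphs in the listed sets, so even the computation
  rule asks for monotone inner graphs.\<close>

lemma lam_lam_Q:
  assumes ad: "adequate U (A \<^bold>\<Rightarrow> B)"
    and F: "\<And>y b. y \<in> D U A \<Longrightarrow> b \<in> Q U A \<Longrightarrow> F y b \<in> Q U B"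
    and mono: "\<And>y. y \<in> D U A \<Longrightarrow> monotone_on (Q U A) (qle U A) (qle U B) (F y)"
  shows lam_lam_in_Q: "lam U (D U A) (\<lambda>y. lam U (Q U A) (F y)) \<in> Q U (A \<^bold>\<Rightarrow> B)"
    and app_app_lam_lam: "x \<in> D U A \<Longrightarrow> b \<in> Q U A \<Longrightarrow>
      app U (app U (lam U (D U A) (\<lambda>y. lam U (Q U A) (F y))) x) b = F x b"
proof -
  let ?M = "mono_maps (Q U A) (qle U A) (Q U B) (qle U B)"
  let ?g = "\<lambda>y b. if b \<in> Q U A then Some (F y b) else None"
  let ?h = "\<lambda>y. if y \<in> D U A then Some (code_fun U (?g y)) else None"
  have g: "?g y \<in> ?M" if "y \<in> D U A" for y
    using restrict_in_maps[of "Q U A" "F y" "Q U B"] F mono that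
    by (auto simp: mono_maps_def monotone_on_def)
  then have h: "?h \<in> maps (D U A) (code_fun U ` ?M)"
    by (intro restrict_in_maps) auto
  have lam: "lam U (D U A) (\<lambda>y. lam U (Q U A) (F y)) = code_fun U ?h"
    by (simp add: lam_def cong: if_cong)
  show "lam U (D U A) (\<lambda>y. lam U (Q U A) (F y)) \<in> Q U (A \<^bold>\<Rightarrow> B)"
    using h by (simp add: lam)
  assume x: "x \<in> D U A" and b: "b \<in> Q U A"
  \<comment> \<open>The outer graph decodes since its values are codes of monotone maps, the inner
    one since it is itself such a map.\<close>
  have "dec_fun U (code_fun U ?h) = ?h" "dec_fun U (code_fun U (?g x)) = ?g x"
    using ad g[OF x] h by auto
  then show "app U (app U (lam U (D U A) (\<lambda>y. lam U (Q U A) (F y))) x) b = F x b"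
    using x b by (simp add: lam app_def)
qed

section \<open>The relations \<rho> and extension of contexts\<close>

lemma rho_carrier: "(x, a, x') \<in> \<rho> U A \<Longrightarrow> x \<in> D U A \<and> a \<in> Q U A \<and> x' \<in> D U A"
  by (cases A) auto

text \<open>At \<open>Real\<close> the distance becomes 0. At a function type the quantifier over
  \<open>g\<close> in the definition of \<open>\<rho>\<close> contains the case
  \<open>g = f\<close>, which is all that the pair of \<open>f\<close> with itself asks.\<close>

lemma rho_left_refl: "(x, a, x') \<in> \<rho> U A \<Longrightarrow> (x, a, x) \<in> \<rho> U A"
  by (induction A arbitrary: x a x') fastforce+

lemma D_ctx_snoc: "xs \<in> D_ctx U \<Gamma> \<Longrightarrow> y \<in> D U A \<Longrightarrow> xs @ [y] \<in> D_ctx U (\<Gamma> @ [A])"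
  by (simp add: D_ctx_def list_all2_appendI)

lemma Q_ctx_snoc: "as \<in> Q_ctx U \<Gamma> \<Longrightarrow> b \<in> Q U A \<Longrightarrow> as @ [b] \<in> Q_ctx U (\<Gamma> @ [A])"
  by (simp add: Q_ctx_def list_all2_appendI)

lemma length_ctx:
  "xs \<in> D_ctx U \<Gamma> \<Longrightarrow> length xs = length \<Gamma>" "as \<in> Q_ctx U \<Gamma> \<Longrightarrow> length as = length \<Gamma>"
  by (auto simp: D_ctx_def Q_ctx_def list_all2_lengthD)

text \<open>Membership in \<open>Q_ctx\<close> supplies the lengths, so that the appended entry sits
  at index \<open>length \<Gamma>\<close> in both lists, the level of the new variable.\<close>

lemma qle_ctx_snoc:
  assumes "as \<in> Q_ctx U \<Gamma>" "as' \<in> Q_ctx U \<Gamma>" "qle_ctx U \<Gamma> as as'" "qle U A b b'"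
  shows "qle_ctx U (\<Gamma> @ [A]) (as @ [b]) (as' @ [b'])"
  using assms length_ctx(2)[OF assms(1)] length_ctx(2)[OF assms(2)]
  by (auto simp: qle_ctx_def nth_append less_Suc_eq)

lemma rho_ctx_snoc:
  assumes "(xs, as, xs') \<in> \<rho>_ctx U \<Gamma>" "(y, b, y') \<in> \<rho> U A"
  shows "(xs @ [y], as @ [b], xs' @ [y']) \<in> \<rho>_ctx U (\<Gamma> @ [A])"
proof -
  have "length xs = length \<Gamma>" "length as = length \<Gamma>" "length xs' = length \<Gamma>"
    using assms(1) by (auto simp: \<rho>_ctx_def length_ctx)
  then show ?thesis
    using assms rho_carrier[OF assms(2)]
    by (auto simp: \<rho>_ctx_def D_ctx_snoc Q_ctx_snoc nth_append less_Suc_eq)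
qed

lemma rho_ctx_left_refl: "(xs, as, xs') \<in> \<rho>_ctx U \<Gamma> \<Longrightarrow> (xs, as, xs) \<in> \<rho>_ctx U \<Gamma>"
  by (auto simp: \<rho>_ctx_def intro: rho_left_refl)

section \<open>Adequacy along typing derivations and values of terms\<close>

declare adequate.simps [simp del]

text \<open>Adequacy is assumed on \<open>occ\<close>; this carries it to the type of a term, in
  particular to the function and product types that have to be decoded.\<close>

lemma typing_in_occ: "\<Gamma> \<turnstile> t : A \<Longrightarrow> A \<in> occ \<Gamma> t"
  by (cases rule: typing.cases) (auto intro: typing.intros)

lemma adequate_typing: "\<Gamma> \<turnstile> t : A \<Longrightarrow> \<forall>B \<in> occ \<Gamma> t. adequate U B \<Longrightarrow> adequate U A"
  using typing_in_occ by blast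

text \<open>Decoding works on values in the carriers; moreover, in the derivative of an application
  the point \<open>sem U s xs\<close> has to be a legal argument.\<close>

lemma sem_in_D:
  "\<Gamma> \<turnstile> t : A \<Longrightarrow> \<forall>B \<in> occ \<Gamma> t. adequate U B \<Longrightarrow> xs \<in> D_ctx U \<Gamma> \<Longrightarrow> sem U t xs \<in> D U A"
proof (induction arbitrary: xs rule: typing.induct)
  case (Var i \<Gamma>)
  then show ?case by (auto simp: D_ctx_def list_all2_conv_all_nth)
next
  case (App \<Gamma> t A B s)
  have "adequate U (A \<^bold>\<Rightarrow> B)" using adequate_typing[OF App.hyps(1), of U] App.prems by simp
  then show ?case using App by (auto intro: app_in_D)
next
  case (Lam \<Gamma> A t B)
  then show ?case by (auto simp del: D.simps intro!: lam_in_D D_ctx_snoc)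
next
  case (Fst \<Gamma> t A B)
  have "adequate U (A \<^bold>\<times> B)" using adequate_typing[OF Fst.hyps, of U] Fst.prems by simp
  then show ?case using Fst by (auto simp del: D.simps intro: proj_in_D)
next
  case (Snd \<Gamma> t A B)
  have "adequate U (A \<^bold>\<times> B)" using adequate_typing[OF Snd.hyps, of U] Snd.prems by simp
  then show ?case using Snd by (auto simp del: D.simps intro: proj_in_D)
qed auto

section \<open>Derivatives of primitives\<close>

text \<open>Larger radii admit more perturbed points \<open>zs\<close>, so the supremum grows. In
  the reversed order this is monotonicity of the derivative.\<close>

lemma deriv_op_mono:
  assumes "length bs = length ys" "length cs = length ys"
    and "\<And>i. i < length ys \<Longrightarrow> bs ! i \<le> cs ! i"
  shows "deriv_op \<phi> ys bs \<le> deriv_op \<phi> ys cs"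
  unfolding deriv_op_def using assms(3) by (intro SUP_subset_mono) (auto intro: order_trans)

text \<open>The point \<open>zs\<close> is one of the competitors in the supremum.\<close>

lemma deriv_op_upper:
  assumes "length zs = length ys"
    and "\<And>i. i < length ys \<Longrightarrow> ennreal \<bar>ys ! i - zs ! i\<bar> \<le> bs ! i"
  shows "ennreal \<bar>\<phi> ys - \<phi> zs\<bar> \<le> deriv_op \<phi> ys bs"
  unfolding deriv_op_def using assms by (intro SUP_upper) auto

section \<open>Derivatives of terms as elements of the quantales\<close>

lemma Q_ctx_funI:
  assumes "\<And>xs as. xs \<in> D_ctx U \<Gamma> \<Longrightarrow> as \<in> Q_ctx U \<Gamma> \<Longrightarrow> F xs as \<in> Q U A"
    and "\<And>xs as as'. xs \<in> D_ctx U \<Gamma> \<Longrightarrow> as \<in> Q_ctx U \<Gamma> \<Longrightarrow> as' \<in> Q_ctx U \<Gamma> \<Longrightarrow>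
      qle_ctx U \<Gamma> as as' \<Longrightarrow> qle U A (F xs as) (F xs as')"
  shows "F \<in> Q_ctx_fun U \<Gamma> A"
  using assms by (auto simp: Q_ctx_fun_def monotone_on_def)

lemma Q_ctx_funD:
  assumes "F \<in> Q_ctx_fun U \<Gamma> A" "xs \<in> D_ctx U \<Gamma>" "as \<in> Q_ctx U \<Gamma>"
  shows Q_ctx_fun_in_Q: "F xs as \<in> Q U A"
    and Q_ctx_fun_mono: "as' \<in> Q_ctx U \<Gamma> \<Longrightarrow> qle_ctx U \<Gamma> as as' \<Longrightarrow> qle U A (F xs as) (F xs as')"
  using assms by (auto simp: Q_ctx_fun_def monotone_on_def)

text \<open>The hypothesis gives monotonicity in the whole extended context. Freezing
  \<open>as\<close> by reflexivity leaves monotonicity in the last entry \<open>b\<close>, as the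
  inner graph of a code in \<open>Q\<close> requires.\<close>

lemma dsem_Lam_body:
  assumes t: "dsem U t \<in> Q_ctx_fun U (\<Gamma> @ [A]) B" and ad: "adequate U (A \<^bold>\<Rightarrow> B)"
    and xs: "xs \<in> D_ctx U \<Gamma>" and as: "as \<in> Q_ctx U \<Gamma>"
  shows dsem_Lam_in_Q: "dsem U (Lam A t) xs as \<in> Q U (A \<^bold>\<Rightarrow> B)"
    and app_dsem_Lam: "y \<in> D U A \<Longrightarrow> b \<in> Q U A \<Longrightarrow>
      app U (app U (dsem U (Lam A t) xs as) y) b = dsem U t (xs @ [y]) (as @ [b])"
proof -
  have F: "dsem U t (xs @ [y]) (as @ [b]) \<in> Q U B" if "y \<in> D U A" "b \<in> Q U A" for y b
    using Q_ctx_fun_in_Q[OF t] xs as that by (simp add: D_ctx_snoc Q_ctx_snoc)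
  have m: "monotone_on (Q U A) (qle U A) (qle U B) (\<lambda>b. dsem U t (xs @ [y]) (as @ [b]))"
    if "y \<in> D U A" for y
  proof (rule monotone_onI)
    fix b b'
    assume b: "b \<in> Q U A" "b' \<in> Q U A" "qle U A b b'"
    have "qle_ctx U \<Gamma> as as" by (simp add: qle_ctx_def qle_refl)
    with b show "qle U B (dsem U t (xs @ [y]) (as @ [b])) (dsem U t (xs @ [y]) (as @ [b']))"
      using xs as that
      by (intro Q_ctx_fun_mono[OF t]) (auto intro: D_ctx_snoc Q_ctx_snoc qle_ctx_snoc)
  qed
  show "dsem U (Lam A t) xs as \<in> Q U (A \<^bold>\<Rightarrow> B)"
    using lam_lam_in_Q[OF ad F m] by simp
  show "y \<in> D U A \<Longrightarrow> b \<in> Q U A \<Longrightarrow>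
      app U (app U (dsem U (Lam A t) xs as) y) b = dsem U t (xs @ [y]) (as @ [b])"
    using app_app_lam_lam[OF ad F m] by simp
qed

lemma dsem_in_Q_ctx_fun:
  "\<Gamma> \<turnstile> t : A \<Longrightarrow> \<forall>B \<in> occ \<Gamma> t. adequate U B \<Longrightarrow> dsem U t \<in> Q_ctx_fun U \<Gamma> A"
proof (induction rule: typing.induct)
  case (Var i \<Gamma>)
  then show ?case
    by (intro Q_ctx_funI) (auto simp: Q_ctx_def list_all2_conv_all_nth qle_ctx_def)
next
  case (Const \<Gamma> r)
  then show ?case by (intro Q_ctx_funI) auto
next
  case (Op ts \<Gamma> \<phi>)
  have ad: "adequate U Real" using Op.prems by simp
  have IH: "dsem U t \<in> Q_ctx_fun U \<Gamma> Real" if "t \<in> set ts" for t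
    using Op that by auto
  show ?case
  proof (rule Q_ctx_funI)
    fix xs as as'
    assume *: "xs \<in> D_ctx U \<Gamma>" "as \<in> Q_ctx U \<Gamma>" "as' \<in> Q_ctx U \<Gamma>" "qle_ctx U \<Gamma> as as'"
    \<comment> \<open>Going up in the order means that the error bounds shrink, hence the swapped
      sides.\<close>
    have "dec_ext U (dsem U t xs as') \<le> dec_ext U (dsem U t xs as)" if "t \<in> set ts" for t
      using Q_ctx_fun_mono[OF IH[OF that] *] by simp
    then show "qle U Real (dsem U (Op \<phi> ts) xs as) (dsem U (Op \<phi> ts) xs as')"
      using ad by (auto intro!: deriv_op_mono)
  qed auto
next
  case (App \<Gamma> t A B s)
  have ad: "adequate U (A \<^bold>\<Rightarrow> B)" using adequate_typing[OF App.hyps(1), of U] App.prems by simp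
  have t: "dsem U t \<in> Q_ctx_fun U \<Gamma> (A \<^bold>\<Rightarrow> B)" and s: "dsem U s \<in> Q_ctx_fun U \<Gamma> A"
    using App by auto
  have sD: "sem U s xs \<in> D U A" if "xs \<in> D_ctx U \<Gamma>" for xs
    using sem_in_D[OF App.hyps(2) _ that] App.prems by simp
  show ?case
  proof (rule Q_ctx_funI)
    fix xs as
    assume *: "xs \<in> D_ctx U \<Gamma>" "as \<in> Q_ctx U \<Gamma>"
    show "dsem U (App t s) xs as \<in> Q U B"
      using app_app_in_Q[OF ad Q_ctx_fun_in_Q[OF t *] sD[OF *(1)] Q_ctx_fun_in_Q[OF s *]] by simp
  next
    fix xs as as'
    assume *: "xs \<in> D_ctx U \<Gamma>" "as \<in> Q_ctx U \<Gamma>" "as' \<in> Q_ctx U \<Gamma>" "qle_ctx U \<Gamma> as as'"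
    let ?f = "\<lambda>as. app U (app U (dsem U t xs as) (sem U s xs))"
    \<comment> \<open>First only the function moves: the pointwise order is evaluated at the old
      argument.\<close>
    have "qle U B (?f as (dsem U s xs as)) (?f as' (dsem U s xs as))"
      using Q_ctx_fun_mono[OF t *] sD[OF *(1)] Q_ctx_fun_in_Q[OF s *(1,2)] by simp
    \<comment> \<open>Then only the argument moves, by monotonicity of the function at
      \<open>as'\<close>.\<close>
    moreover have "qle U B (?f as' (dsem U s xs as)) (?f as' (dsem U s xs as'))"
      using app_app_mono[OF ad Q_ctx_fun_in_Q[OF t *(1,3)] sD[OF *(1)]]
        Q_ctx_fun_in_Q[OF s *(1,2)] Q_ctx_fun_in_Q[OF s *(1,3)] Q_ctx_fun_mono[OF s *]
      by (rule monotone_onD)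
    ultimately show "qle U B (dsem U (App t s) xs as) (dsem U (App t s) xs as')"
      by (auto intro: qle_trans)
  qed
next
  case (Lam \<Gamma> A t B)
  have ad: "adequate U (A \<^bold>\<Rightarrow> B)"
    using adequate_typing[OF typing.Lam[OF Lam.hyps] Lam.prems] .
  have t: "dsem U t \<in> Q_ctx_fun U (\<Gamma> @ [A]) B" using Lam by simp
  show ?case
  proof (rule Q_ctx_funI)
    fix xs as as'
    assume *: "xs \<in> D_ctx U \<Gamma>" "as \<in> Q_ctx U \<Gamma>" "as' \<in> Q_ctx U \<Gamma>" "qle_ctx U \<Gamma> as as'"
    \<comment> \<open>The order at a function type compares at equal \<open>y\<close> and
      \<open>b\<close>, so only the context part moves.\<close>
    have "qle U B (dsem U t (xs @ [y]) (as @ [b])) (dsem U t (xs @ [y]) (as' @ [b]))"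
      if "y \<in> D U A" "b \<in> Q U A" for y b
      using * that
      by (intro Q_ctx_fun_mono[OF t]) (auto intro: D_ctx_snoc Q_ctx_snoc qle_ctx_snoc qle_refl)
    then show "qle U (A \<^bold>\<Rightarrow> B) (dsem U (Lam A t) xs as) (dsem U (Lam A t) xs as')"
      using * by (simp add: app_dsem_Lam[OF t ad] del: dsem.simps)
  qed (rule dsem_Lam_in_Q[OF t ad])
next
  case (Pair \<Gamma> t A s B)
  have ad: "adequate U (A \<^bold>\<times> B)"
    using adequate_typing[OF typing.Pair[OF Pair.hyps] Pair.prems] .
  have "dsem U t \<in> Q_ctx_fun U \<Gamma> A" "dsem U s \<in> Q_ctx_fun U \<Gamma> B" using Pair by auto
  note Q = Q_ctx_fun_in_Q[OF this(1)] Q_ctx_fun_in_Q[OF this(2)]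
    Q_ctx_fun_mono[OF this(1)] Q_ctx_fun_mono[OF this(2)]
  show ?case
    by (rule Q_ctx_funI) (auto simp: Q proj_code_pair_Q[OF ad])
next
  case (Fst \<Gamma> t A B)
  have ad: "adequate U (A \<^bold>\<times> B)" using adequate_typing[OF Fst.hyps, of U] Fst.prems by simp
  have t: "dsem U t \<in> Q_ctx_fun U \<Gamma> (A \<^bold>\<times> B)" using Fst by simp
  show ?case
    using proj_in_Q(1)[OF ad Q_ctx_fun_in_Q[OF t]] Q_ctx_fun_mono[OF t]
    by (intro Q_ctx_funI) auto
next
  case (Snd \<Gamma> t A B)
  have ad: "adequate U (A \<^bold>\<times> B)" using adequate_typing[OF Snd.hyps, of U] Snd.prems by simp
  have t: "dsem U t \<in> Q_ctx_fun U \<Gamma> (A \<^bold>\<times> B)" using Snd by simp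
  show ?case
    using proj_in_Q(2)[OF ad Q_ctx_fun_in_Q[OF t]] Q_ctx_fun_mono[OF t]
    by (intro Q_ctx_funI) auto
qed

section \<open>Compatibility of terms with the relations\<close>

lemma sem_rho:
  "\<Gamma> \<turnstile> t : A \<Longrightarrow> \<forall>B \<in> occ \<Gamma> t. adequate U B \<Longrightarrow> (xs, as, xs') \<in> \<rho>_ctx U \<Gamma> \<Longrightarrow>
   (sem U t xs, dsem U t xs as, sem U t xs') \<in> \<rho> U A"
proof (induction arbitrary: xs as xs' rule: typing.induct)
  case (Var i \<Gamma>)
  then show ?case by (auto simp: \<rho>_ctx_def)
next
  case (Const \<Gamma> r)
  then show ?case by simp
next
  case (Op ts \<Gamma> \<phi>)
  have ad: "adequate U Real" using Op.prems by simp
  have "(sem U t xs, dsem U t xs as, sem U t xs') \<in> \<rho> U Real" if "t \<in> set ts" for t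
  proof (rule Op.IH[OF that _ Op.prems(2)])
    show "\<forall>B \<in> occ \<Gamma> t. adequate U B" using Op.prems(1) that by auto
  qed
  then have *: "ennreal \<bar>dec_real U (sem U t xs) - dec_real U (sem U t xs')\<bar>
      \<le> dec_ext U (dsem U t xs as)" if "t \<in> set ts" for t
    using that by auto
  \<comment> \<open>The perturbed point in \<open>deriv_op_upper\<close> is the list of values at
    \<open>xs'\<close>.\<close>
  show ?case
    using ad by (auto intro!: deriv_op_upper *)
next
  case (App \<Gamma> t A B s)
  have "(sem U t xs, dsem U t xs as, sem U t xs') \<in> \<rho> U (A \<^bold>\<Rightarrow> B)"
    and "(sem U s xs, dsem U s xs as, sem U s xs') \<in> \<rho> U A"
    using App by auto
  \<comment> \<open>The clause for functions is taken at \<open>g = sem U t xs'\<close>, where both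
    the function and the argument differ between the two sides.\<close>
  then show ?case by fastforce
next
  case (Lam \<Gamma> A t B)
  note Lam_typing = typing.Lam[OF Lam.hyps]
  have ad: "adequate U (A \<^bold>\<Rightarrow> B)" using adequate_typing[OF Lam_typing Lam.prems(1)] .
  have occ: "\<forall>C \<in> occ (\<Gamma> @ [A]) t. adequate U C" using Lam.prems(1) by simp
  note d = dsem_in_Q_ctx_fun[OF Lam.hyps occ]
  have ctx: "xs \<in> D_ctx U \<Gamma>" "as \<in> Q_ctx U \<Gamma>" "xs' \<in> D_ctx U \<Gamma>"
    using Lam.prems(2) by (auto simp: \<rho>_ctx_def)
  \<comment> \<open>Evaluating a coded abstraction needs its graph to take values in
    \<open>D U B\<close>, which \<open>sem_in_D\<close> provides in the extended context.\<close>
  have app: "app U (sem U (Lam A t) zs) y = sem U t (zs @ [y])"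
    if "zs \<in> D_ctx U \<Gamma>" "y \<in> D U A" for zs y
    using app_lam_D[OF ad sem_in_D[OF Lam.hyps occ] that(2)] that(1) by (simp add: D_ctx_snoc)
  have "(app U (sem U (Lam A t) xs) y, app U (app U (dsem U (Lam A t) xs as) y) b,
      app U g y') \<in> \<rho> U B"
    if y: "(y, b, y') \<in> \<rho> U A" and g: "g \<in> {sem U (Lam A t) xs, sem U (Lam A t) xs'}" for y b y' g
  proof -
    \<comment> \<open>Both choices of \<open>g\<close> are treated at once: \<open>zs\<close> is
      \<open>xs'\<close> or, by left quasi-reflexivity, \<open>xs\<close>. The induction hypothesis
      then applies to the extended triple.\<close>
    obtain zs where zs: "g = sem U (Lam A t) zs" "(xs, as, zs) \<in> \<rho>_ctx U \<Gamma>"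
      using g Lam.prems(2) rho_ctx_left_refl[OF Lam.prems(2)] by blast
    then have "zs \<in> D_ctx U \<Gamma>" by (auto simp: \<rho>_ctx_def)
    then show ?thesis
      using Lam.IH[OF occ rho_ctx_snoc[OF zs(2) y]] rho_carrier[OF y] ctx
      by (simp add: zs(1) app app_dsem_Lam[OF d ad] del: sem.simps dsem.simps)
  qed
  then show ?case
    using sem_in_D[OF Lam_typing Lam.prems(1)] dsem_Lam_in_Q[OF d ad ctx(1,2)] ctx
    by (auto simp del: sem.simps dsem.simps D.simps Q.simps)
next
  case (Pair \<Gamma> t A s B)
  have ad: "adequate U (A \<^bold>\<times> B)"
    using adequate_typing[OF typing.Pair[OF Pair.hyps] Pair.prems(1)] .
  have t: "(sem U t xs, dsem U t xs as, sem U t xs') \<in> \<rho> U A"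
    and s: "(sem U s xs, dsem U s xs as, sem U s xs') \<in> \<rho> U B"
    using Pair by auto
  show ?case
    using t s rho_carrier[OF t] rho_carrier[OF s]
    by (auto simp: proj_code_pair_D[OF ad] proj_code_pair_Q[OF ad])
next
  case (Fst \<Gamma> t A B)
  then have "(sem U t xs, dsem U t xs as, sem U t xs') \<in> \<rho> U (A \<^bold>\<times> B)" by simp
  then show ?case by simp
next
  case (Snd \<Gamma> t A B)
  then have "(sem U t xs, dsem U t xs as, sem U t xs') \<in> \<rho> U (A \<^bold>\<times> B)" by simp
  then show ?case by simp
qed

theorem theorem5p1:
  fixes U :: "'u universe" and \<Gamma> :: "ty list" and t :: tm and A :: ty
  assumes "\<Gamma> \<turnstile> t : A"
    and "\<forall>B \<in> occ \<Gamma> t. adequate U B"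
  shows "dsem U t \<in> Q_ctx_fun U \<Gamma> A \<and>
         (\<forall>(x, a, x') \<in> \<rho>_ctx U \<Gamma>. (sem U t x, dsem U t x a, sem U t x') \<in> \<rho> U A)"
  using dsem_in_Q_ctx_fun[OF assms] sem_rho[OF assms] by blast

end
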